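(* Let $R$ be a $*$-ring (associative with unity), let $n\in\mathbb{N}$ and let $a,b,c\in R$ satisfy $aba=ba^2=a^2c=aca$. Put $\alpha=1-ba$ and $\beta=1-ac$. Then $\alpha$ is $pns$-$*$-Drazin invertible if and only if $\beta$ is $pns$-$*$-Drazin invertible. In this case, $$\alpha^\diamond=1-b\beta^{\pi}v(ac)^2a+b\beta\beta^\diamond a+b\beta^\diamond aba$$ and $$\beta^\diamond=1-a\alpha^{\pi}u(ba)^2c+a\alpha\alpha^\diamond c+a\alpha^\diamond cac,$$ where $\alpha^{\pi}=1-\alpha\alpha^\diamond$, $\beta^{\pi}=1-\beta\beta^\diamond$, $v=\bigl(1-\beta\beta^{\pi}\sum_{i=0}^{2}(ac)^i\bigr)^{-1}$ and $u=\bigl(1-\alpha\alpha^{\pi}\sum_{i=0}^{2}(ba)^i\bigr)^{-1}$.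
   Context: $\mathbb{N}$ is the set of positive integers. A $*$-ring is a ring $R$ with a map $*:R\to R$ such that $(x+y)^*=x^*+y^*$, $(xy)^*=y^*x^*$ and $(x^* )^*=x$ for all $x,y\in R$. $J(R)$ is the Jacobson radical and $\sqrt{J(R)}=\{x\in R: x^k\in J(R)\text{ for some }k\ge 1\}$. For $x\in R$: $\mathrm{comm}(x)=\{y\in R: xy=yx\}$ and $\mathrm{comm}^2(x)=\{y\in R: yz=zy\text{ for all }z\in\mathrm{comm}(x)\}$. For fixed $n\in\mathbb{N}$, an element $a$ of a $*$-ring $R$ is $pns$-$*$-Drazin invertible if there exists $x\in R$ with $x\in\mathrm{comm}^2(a)$, $xax=x$, $(ax)^*=ax$ and $a^n-ax\in\sqrt{J(R)}$. Such an $x$ is unique when it exists, is called the $pns$-$*$-Drazin inverse of $a$, and is denoted $a^\diamond$. The same $n$ is used for all elements. The existence of the inverses defining $u$ and $v$ is part of the assertion. *)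

theory Defs
  imports Main
begin

text \<open>
  Associative unital rings with involution.  The class is built from \<open>ring\<close> and
  \<open>monoid_mult\<close> instead of \<open>ring_1\<close>, because the latter excludes the zero ring.
\<close>

class star_ring = ring + monoid_mult +
  fixes star :: "'a \<Rightarrow> 'a"
  assumes star_add: "star (x + y) = star x + star y"
    and star_mult: "star (x * y) = star y * star x"
    and star_star: "star (star x) = x"

text \<open>Closure of a left ideal under negation follows from closure under multiplication by \<open>- 1\<close>.\<close>

definition left_ideal :: "'a::{ring,monoid_mult} set \<Rightarrow> bool" where
  "left_ideal I \<longleftrightarrow> 0 \<in> I \<and> (\<forall>x\<in>I. \<forall>y\<in>I. x + y \<in> I) \<and> (\<forall>r. \<forall>x\<in>I. r * x \<in> I)"

definition maximal_left_ideal :: "'a::{ring,monoid_mult} set \<Rightarrow> bool" where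
  "maximal_left_ideal M \<longleftrightarrow>
     left_ideal M \<and> M \<noteq> UNIV \<and> (\<forall>I. left_ideal I \<and> M \<subseteq> I \<longrightarrow> I = M \<or> I = UNIV)"

definition jacobson_radical :: "'a::{ring,monoid_mult} set" where
  "jacobson_radical = \<Inter> {M. maximal_left_ideal M}"

definition sqrt_jacobson_radical :: "'a::{ring,monoid_mult} set" where
  "sqrt_jacobson_radical = {x. \<exists>k::nat. k \<ge> 1 \<and> x ^ k \<in> jacobson_radical}"

definition comm :: "'a::{ring,monoid_mult} \<Rightarrow> 'a set" where
  "comm x = {y. x * y = y * x}"

definition comm2 :: "'a::{ring,monoid_mult} \<Rightarrow> 'a set" where
  "comm2 x = {y. \<forall>z\<in>comm x. y * z = z * y}"

definition is_inverse :: "'a::{ring,monoid_mult} \<Rightarrow> 'a \<Rightarrow> bool" where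
  "is_inverse x y \<longleftrightarrow> x * y = 1 \<and> y * x = 1"

definition is_pns_star_Drazin_inverse :: "nat \<Rightarrow> 'a::star_ring \<Rightarrow> 'a \<Rightarrow> bool" where
  "is_pns_star_Drazin_inverse n a x \<longleftrightarrow>
     x \<in> comm2 a \<and> x * a * x = x \<and> star (a * x) = a * x \<and>
     a ^ n - a * x \<in> sqrt_jacobson_radical"

definition pns_star_Drazin_invertible :: "nat \<Rightarrow> 'a::star_ring \<Rightarrow> bool" where
  "pns_star_Drazin_invertible n a \<longleftrightarrow> (\<exists>x. is_pns_star_Drazin_inverse n a x)"

text \<open>For \<open>n \<ge> 1\<close> such an \<open>x\<close> is unique whenever it exists, which makes \<open>THE\<close> appropriate here.\<close>

definition pns_star_Drazin_inv :: "nat \<Rightarrow> 'a::star_ring \<Rightarrow> 'a" where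
  "pns_star_Drazin_inv n a = (THE x. is_pns_star_Drazin_inverse n a x)"

definition spectral_idem :: "nat \<Rightarrow> 'a::star_ring \<Rightarrow> 'a" where
  "spectral_idem n a = 1 - a * pns_star_Drazin_inv n a"

end

theory Submission
  imports Defs
begin

text \<open>
  Put \<open>p = ba\<close> and \<open>q = ac\<close>. The hypotheses say that \<open>a\<close> commutes with \<open>p\<close> and \<open>q\<close>, and they give
  \<open>p\<^sup>2 = pq = q\<^sup>2\<close>, so \<open>f(p) = f(q)\<close> for every polynomial \<open>f\<close> divisible by \<open>X\<^sup>2\<close>.
  Let \<open>\<pi>\<close> be the spectral idempotent of \<open>1 - p\<close>. As \<open>(1 - p)\<pi>\<close> has a power in the Jacobson radical,
  \<open>p\<close> is invertible in the corner of \<open>\<pi>\<close>, so \<open>\<pi>\<close> is a multiple of \<open>p\<^sup>3\<close>, and therefore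
  \<open>\<pi>p = \<pi>q = q\<pi>\<close> and \<open>\<pi>\<close> lies in the double commutant of \<open>q\<close>. Hence \<open>1 - p\<close> and \<open>1 - q\<close> have the
  same spectral idempotent, which settles the involution. Finally
  \<open>((1 - p)\<^sup>n - e)\<^sup>2 = ((1 - q)\<^sup>n - e)\<^sup>2\<close> for \<open>e = 1 - \<pi>\<close>, because \<open>((1 - X)\<^sup>n - 1)\<^sup>2\<close> is
  divisible by \<open>X\<^sup>2\<close>.
\<close>

section \<open>Maximal left ideals, the Jacobson radical and units\<close>

lemma left_ideal_jacobson_radical: "left_ideal (jacobson_radical :: 'a::{ring,monoid_mult} set)"
  unfolding jacobson_radical_def maximal_left_ideal_def left_ideal_def by auto

lemma jacobson_radical_mult_left:
  fixes x :: "'a::{ring,monoid_mult}"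
  shows "x \<in> jacobson_radical \<Longrightarrow> r * x \<in> jacobson_radical"
  using left_ideal_jacobson_radical unfolding left_ideal_def by blast

lemma left_ideal_eq_UNIV:
  fixes I :: "'a::{ring,monoid_mult} set"
  assumes "left_ideal I" "1 \<in> I"
  shows "I = UNIV"
proof -
  have "r * 1 \<in> I" for r using assms unfolding left_ideal_def by blast
  then show ?thesis by auto
qed

lemma left_ideal_Union_chain:
  fixes C :: "'a::{ring,monoid_mult} set set"
  assumes "C \<noteq> {}" "subset.chain A C" "\<And>I. I \<in> C \<Longrightarrow> left_ideal I"
  shows "left_ideal (\<Union>C)"
  unfolding left_ideal_def
proof (intro conjI ballI allI)
  show "0 \<in> \<Union>C" using assms(1,3) unfolding left_ideal_def by blast
next
  fix x y assume "x \<in> \<Union>C" "y \<in> \<Union>C"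
  then obtain I K where IK: "I \<in> C" "K \<in> C" "x \<in> I" "y \<in> K" by blast
  then have "I \<subseteq> K \<or> K \<subseteq> I" using assms(2) unfolding subset_chain_def by blast
  then obtain L where "L \<in> C" "x \<in> L" "y \<in> L" using IK by blast
  then show "x + y \<in> \<Union>C" using assms(3) unfolding left_ideal_def by blast
next
  fix r x assume "x \<in> \<Union>C"
  then show "r * x \<in> \<Union>C" using assms(3) unfolding left_ideal_def by blast
qed

text \<open>Zorn's lemma is applied to the left ideals that contain \<open>I\<close> and omit 1. For
  a left ideal, omitting 1 is the same as being proper, and it survives unions of chains.\<close>

lemma maximal_left_ideal_exists:
  fixes I :: "'a::{ring,monoid_mult} set"
  assumes "left_ideal I" "1 \<notin> I"
  shows "\<exists>M. maximal_left_ideal M \<and> I \<subseteq> M"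
proof -
  define A where "A = {K. left_ideal K \<and> I \<subseteq> K \<and> 1 \<notin> K}"
  have "A \<noteq> {}" using assms A_def by blast
  then have "\<exists>M\<in>A. \<forall>X\<in>A. M \<subseteq> X \<longrightarrow> X = M"
  proof (rule subset_Zorn_nonempty)
    fix C assume C: "C \<noteq> {}" "subset.chain A C"
    then have "C \<subseteq> A" unfolding subset_chain_def by blast
    moreover from this have "left_ideal (\<Union>C)"
      using left_ideal_Union_chain[OF C] A_def by blast
    ultimately show "\<Union>C \<in> A" using C(1) unfolding A_def by blast
  qed
  then obtain M where M: "M \<in> A" "\<And>X. X \<in> A \<Longrightarrow> M \<subseteq> X \<Longrightarrow> X = M" by blast
  have "K = M \<or> K = UNIV" if "left_ideal K" "M \<subseteq> K" for K
    using M that left_ideal_eq_UNIV unfolding A_def by blast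
  then have "maximal_left_ideal M" using M(1) unfolding maximal_left_ideal_def A_def by blast
  then show ?thesis using M(1) A_def by blast
qed

text \<open>Otherwise the left ideal generated by \<open>1 - j\<close> is proper and lies in a
  maximal one, which also contains \<open>j\<close> and hence 1.\<close>

lemma left_inverse_one_minus_jacobson_radical:
  fixes j :: "'a::{ring,monoid_mult}"
  assumes "j \<in> jacobson_radical"
  shows "\<exists>s. s * (1 - j) = 1"
proof (rule ccontr)
  assume neg: "\<nexists>s. s * (1 - j) = 1"
  define I where "I = range (\<lambda>r. r * (1 - j))"
  have "x + y \<in> I" if "x \<in> I" "y \<in> I" for x y
    using that unfolding I_def by (auto simp: distrib_right[symmetric])
  moreover have "r * x \<in> I" if "x \<in> I" for r x
    using that unfolding I_def by (auto simp: mult.assoc[symmetric])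
  moreover have "0 \<in> I" unfolding I_def by (auto intro: range_eqI[where x=0])
  ultimately have "left_ideal I" unfolding left_ideal_def by blast
  moreover have "1 \<notin> I" using neg unfolding I_def by (metis rangeE)
  ultimately obtain M where M: "maximal_left_ideal M" "I \<subseteq> M"
    using maximal_left_ideal_exists by blast
  have "j \<in> M" using assms M(1) unfolding jacobson_radical_def by blast
  moreover have "1 - j \<in> M" using M(2) unfolding I_def by (auto intro: range_eqI[where x=1])
  moreover have "left_ideal M" using M(1) unfolding maximal_left_ideal_def by blast
  ultimately have "(1 - j) + j \<in> M" unfolding left_ideal_def by blast
  then show False
    using M(1) left_ideal_eq_UNIV unfolding maximal_left_ideal_def by auto
qed

text \<open>A left inverse \<open>s\<close> equals \<open>1 + s * j\<close>, so it is again 1 minus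
  an element of the radical and has a left inverse \<open>t\<close> of its own. Then
  \<open>s\<close> is invertible on both sides and \<open>t = 1 - j\<close>.\<close>

lemma unit_one_minus_jacobson_radical:
  fixes j :: "'a::{ring,monoid_mult}"
  assumes "j \<in> jacobson_radical"
  shows "\<exists>s. is_inverse (1 - j) s"
proof -
  obtain s where s: "s * (1 - j) = 1" using left_inverse_one_minus_jacobson_radical[OF assms] by blast
  then have "s = 1 - (- s) * j" by (simp add: algebra_simps)
  then obtain t where t: "t * s = 1"
    using left_inverse_one_minus_jacobson_radical[OF jacobson_radical_mult_left[OF assms, of "- s"]]
    by metis
  have "t = t * (s * (1 - j))" using s by simp
  also have "\<dots> = 1 - j" using t by (simp only: mult.assoc[symmetric] mult_1_left)
  finally show ?thesis using s t unfolding is_inverse_def by metis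
qed

text \<open>The idempotent annihilates \<open>1 - f\<close>, which is a unit.\<close>

lemma idempotent_jacobson_radical:
  fixes f :: "'a::{ring,monoid_mult}"
  assumes "f \<in> jacobson_radical" "f * f = f"
  shows "f = 0"
proof -
  obtain s where s: "(1 - f) * s = 1"
    using unit_one_minus_jacobson_radical[OF assms(1)] unfolding is_inverse_def by blast
  have "f = f * ((1 - f) * s)" using s by simp
  also have "\<dots> = 0" using assms(2) by (simp add: algebra_simps mult.assoc[symmetric])
  finally show ?thesis .
qed

section \<open>Units from elements with a power in the radical\<close>

lemma one_minus_power_factor:
  fixes y :: "'a::{ring,monoid_mult}"
  shows "\<exists>g. 1 - y ^ m = (1 - y) * g \<and> 1 - y ^ m = g * (1 - y)"
proof (induction m)
  case 0
  show ?case by (rule exI[of _ 0]) simp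
next
  case (Suc m)
  then obtain g where g: "1 - y ^ m = (1 - y) * g" "1 - y ^ m = g * (1 - y)" by blast
  have "1 - y ^ Suc m = (1 - y ^ m) + (1 - y) * y ^ m" by (simp add: algebra_simps)
  moreover have "1 - y ^ Suc m = (1 - y ^ m) + y ^ m * (1 - y)"
    by (simp add: algebra_simps power_commutes)
  ultimately show ?case using g by (metis distrib_left distrib_right)
qed

text \<open>The unit \<open>1 - y ^ m\<close> is a left and a right multiple of \<open>1 - y\<close>
  with the same cofactor \<open>g\<close>. This yields a right inverse \<open>g * s\<close> and a
  left inverse \<open>s * g\<close>, which must agree.\<close>

lemma unit_one_minus_of_power:
  fixes y :: "'a::{ring,monoid_mult}"
  assumes "y ^ m \<in> jacobson_radical"
  shows "\<exists>s. is_inverse (1 - y) s"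
proof -
  obtain s where s: "(1 - y ^ m) * s = 1" "s * (1 - y ^ m) = 1"
    using unit_one_minus_jacobson_radical[OF assms] unfolding is_inverse_def by blast
  obtain g where g: "1 - y ^ m = (1 - y) * g" "1 - y ^ m = g * (1 - y)"
    using one_minus_power_factor by blast
  have right: "(1 - y) * (g * s) = 1" using s(1) g(1) by (simp add: mult.assoc)
  have left: "(s * g) * (1 - y) = 1" using s(2) g(2) by (simp add: mult.assoc)
  have "s * g = (s * g) * ((1 - y) * (g * s))" using right by simp
  also have "\<dots> = g * s" using left by (simp only: mult.assoc[symmetric] mult_1_left)
  finally show ?thesis using left right unfolding is_inverse_def by metis
qed

lemma idempotent_power:
  fixes e :: "'a::monoid_mult"
  assumes "e * e = e" "m \<ge> 1"
  shows "e ^ m = e"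
  using assms(2) by (induction m rule: dec_induct) (use assms(1) in simp_all)

lemma commuting_power_mult:
  fixes x y :: "'a::monoid_mult"
  assumes "x * y = y * x"
  shows "(x * y) ^ m = x ^ m * y ^ m"
proof (induction m)
  case (Suc m)
  have "y * x ^ m = x ^ m * y" using assms by (metis power_commuting_commutes)
  then show ?case using Suc by (simp add: mult.assoc) (metis mult.assoc)
qed simp

section \<open>Double commutants and uniqueness of the pns-star-Drazin inverse\<close>

lemma comm_one_minus [simp]:
  fixes p :: "'a::{ring,monoid_mult}"
  shows "comm (1 - p) = comm p" and "comm2 (1 - p) = comm2 p"
proof -
  show "comm (1 - p) = comm p" unfolding comm_def by (auto simp: algebra_simps)
  then show "comm2 (1 - p) = comm2 p" unfolding comm2_def by simp
qed

lemma pns_inverse_commutes: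
  assumes "is_pns_star_Drazin_inverse n a x" "a * z = z * a"
  shows "x * z = z * x"
  using assms unfolding is_pns_star_Drazin_inverse_def comm2_def comm_def by blast

lemma pns_inverse_idempotent:
  assumes "is_pns_star_Drazin_inverse n a x"
  shows "(a * x) * (a * x) = a * x"
  using assms unfolding is_pns_star_Drazin_inverse_def by (simp add: mult.assoc)

text \<open>The complementary idempotent commutes with \<open>a\<close> and kills
  \<open>a * x\<close>, so multiplying \<open>(a ^ n - a * x) ^ k\<close> by it leaves only its
  product with \<open>a ^ (n * k)\<close>.\<close>

lemma pns_inverse_complement_power:
  assumes "is_pns_star_Drazin_inverse n a x" "n \<ge> 1"
  shows "\<exists>m\<ge>1. (1 - a * x) * a ^ m \<in> jacobson_radical"
proof -
  define f where "f = 1 - a * x"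
  obtain k where k: "k \<ge> 1" "(a ^ n - a * x) ^ k \<in> jacobson_radical"
    using assms(1) unfolding is_pns_star_Drazin_inverse_def sqrt_jacobson_radical_def by blast
  have xa: "x * a = a * x" using pns_inverse_commutes[OF assms(1)] by simp
  have "f * (a * x) = 0"
    using pns_inverse_idempotent[OF assms(1)] by (simp add: f_def algebra_simps)
  then have w: "f * (a ^ n - a * x) = f * a ^ n" by (simp add: right_diff_distrib)
  have fa: "f * a = a * f" using xa unfolding f_def by (simp add: algebra_simps)
  have "f * (a ^ n - a * x) ^ i = f * a ^ (n * i)" for i
  proof (induction i)
    case (Suc i)
    have fi: "f * a ^ (n * i) = a ^ (n * i) * f" using fa by (metis power_commuting_commutes)
    have "f * (a ^ n - a * x) ^ Suc i = f * (a ^ n - a * x) ^ i * (a ^ n - a * x)"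
      by (simp add: power_commutes mult.assoc)
    also have "\<dots> = a ^ (n * i) * (f * a ^ n)" using Suc fi w by (simp add: mult.assoc)
    also have "\<dots> = f * (a ^ (n * i) * a ^ n)" using fi by (simp add: mult.assoc[symmetric])
    also have "\<dots> = f * a ^ (n * Suc i)" by (simp add: power_add[symmetric] add.commute)
    finally show ?case .
  qed simp
  then have "f * a ^ (n * k) \<in> jacobson_radical"
    using jacobson_radical_mult_left[OF k(2), of f] by simp
  moreover have "n * k \<ge> 1" using k(1) assms(2) by (simp add: Suc_le_eq)
  ultimately show ?thesis unfolding f_def by blast
qed

text \<open>The product of \<open>a * x\<close> with the complement of \<open>a * y\<close> is an
  idempotent lying in the radical, hence zero.\<close>

lemma pns_inverse_idempotents_absorb:
  assumes x: "is_pns_star_Drazin_inverse n a x" and y: "is_pns_star_Drazin_inverse n a y" and "n \<ge> 1"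
  shows "a * x = (a * x) * (a * y)"
proof -
  obtain m where m: "m \<ge> 1" "(1 - a * y) * a ^ m \<in> jacobson_radical"
    using pns_inverse_complement_power[OF y assms(3)] by blast
  define e f where "e = a * x" and "f = 1 - a * y"
  have xa: "x * a = a * x" using pns_inverse_commutes[OF x] by simp
  have ya: "y * a = a * y" using pns_inverse_commutes[OF y] by simp
  have fa: "a * f = f * a" using ya unfolding f_def by (simp add: algebra_simps)
  then have xf: "x * f = f * x" using pns_inverse_commutes[OF x] by blast
  have ee: "e * e = e" using pns_inverse_idempotent[OF x] e_def by simp
  have ff: "f * f = f" using pns_inverse_idempotent[OF y] by (simp add: f_def algebra_simps)
  have ef: "e * f = f * e" unfolding e_def using xf fa by (metis mult.assoc)
  \<comment> \<open>Multiplication by \<open>x ^ m\<close> undoes \<open>a ^ m\<close> on the corner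
    of \<open>e\<close>, which exhibits \<open>e * f\<close> as a left multiple of the radical
    element \<open>f * a ^ m\<close>.\<close>
  have "x ^ m * a ^ m = e"
    using commuting_power_mult[OF xa] idempotent_power[OF ee m(1)] xa e_def by metis
  moreover have "f * a ^ m = a ^ m * f" using fa by (metis power_commuting_commutes)
  ultimately have "x ^ m * (f * a ^ m) = e * f" by (metis mult.assoc)
  then have "e * f \<in> jacobson_radical"
    using jacobson_radical_mult_left[OF m(2), of "x ^ m"] f_def by simp
  moreover have "(e * f) * (e * f) = e * f" using ee ff ef by (metis mult.assoc)
  ultimately have "e * f = 0" using idempotent_jacobson_radical by blast
  then show ?thesis unfolding f_def e_def[symmetric] by (simp add: right_diff_distrib)
qed

text \<open>Absorption in both orders gives \<open>a * x = a * y\<close>, and then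
  \<open>x = x * a * x = x * a * y = a * y * y = y\<close>.\<close>

lemma pns_inverse_unique:
  assumes x: "is_pns_star_Drazin_inverse n a x" and y: "is_pns_star_Drazin_inverse n a y" and "n \<ge> 1"
  shows "x = y"
proof -
  have xa: "x * a = a * x" using pns_inverse_commutes[OF x] by simp
  have ya: "y * a = a * y" using pns_inverse_commutes[OF y] by simp
  have xy: "x * y = y * x" using pns_inverse_commutes[OF x] ya by simp
  have "(a * x) * (a * y) = (a * y) * (a * x)" using xa ya xy by (metis mult.assoc)
  then have e: "a * x = a * y"
    using pns_inverse_idempotents_absorb[OF x y] pns_inverse_idempotents_absorb[OF y x] assms(3) by simp
  have "x = x * (a * x)" "y = (a * y) * y"
    using x y ya unfolding is_pns_star_Drazin_inverse_def by (metis mult.assoc)+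
  then show ?thesis using e xa by (metis mult.assoc)
qed

lemma pns_star_Drazin_inv_eqI:
  assumes "is_pns_star_Drazin_inverse n a x" "n \<ge> 1"
  shows "pns_star_Drazin_inv n a = x"
  unfolding pns_star_Drazin_inv_def using assms pns_inverse_unique by blast

section \<open>The units behind \<open>u\<close> and \<open>v\<close>\<close>

lemma is_inverse_commutes:
  fixes w :: "'a::{ring,monoid_mult}"
  assumes "is_inverse w s" "w * z = z * w"
  shows "s * z = z * s"
proof -
  have "s * z = s * (z * w) * s" using assms(1) unfolding is_inverse_def by (simp add: mult.assoc)
  also have "\<dots> = s * (w * z) * s" using assms(2) by simp
  also have "\<dots> = z * s"
    using assms(1) unfolding is_inverse_def by (simp add: mult.assoc[symmetric])
  finally show ?thesis .
qed

text \<open>The unit below equals \<open>e + \<pi>p\<^sup>3\<close> for \<open>e = (1 - p)x\<close> and \<open>\<pi> = 1 - e\<close>; it is the cube of \<open>e + \<pi>p\<close>.\<close>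

lemma pns_inverse_unit:
  assumes x: "is_pns_star_Drazin_inverse n (1 - p) x" and "n \<ge> 1"
  shows "\<exists>u. is_inverse (1 - (1 - p) * (1 - (1 - p) * x) * (1 + p + p ^ 2)) u \<and> u \<in> comm2 p \<and>
    u * (1 - (1 - p) * x) * p ^ 3 = 1 - (1 - p) * x"
proof -
  define f where "f = 1 - (1 - p) * x"
  have fz: "f * z = z * f" if "p * z = z * p" for z
  proof -
    have *: "(1 - p) * z = z * (1 - p)" using that by (simp add: algebra_simps)
    then have "(1 - p) * x * z = z * ((1 - p) * x)"
      using pns_inverse_commutes[OF x *] by (metis mult.assoc)
    then show ?thesis unfolding f_def by (simp add: left_diff_distrib right_diff_distrib)
  qed
  then have fp: "f * p = p * f" by simp
  have ff: "f * f = f" using pns_inverse_idempotent[OF x] by (simp add: f_def algebra_simps)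
  have fa: "f * (1 - p) = (1 - p) * f" using fp by (simp add: algebra_simps)
  obtain m where m: "m \<ge> 1" "f * (1 - p) ^ m \<in> jacobson_radical"
    using pns_inverse_complement_power[OF x assms(2)] unfolding f_def by blast
  have "(f * (1 - p)) ^ m = f * (1 - p) ^ m"
    using commuting_power_mult[OF fa] idempotent_power[OF ff m(1)] by simp
  then obtain s where s: "is_inverse (1 - f * (1 - p)) s"
    using m(2) unit_one_minus_of_power by metis
  \<comment> \<open>\<open>w\<close> acts as 1 on the corner of \<open>1 - f\<close> and as
    \<open>p\<close> on the corner of \<open>f\<close>. It is a unit because
    \<open>f * (1 - p)\<close> has a power in the radical.\<close>
  define w where "w = 1 - f * (1 - p)"
  have ws: "w * s = 1" "s * w = 1" using s unfolding w_def is_inverse_def by auto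
  have fw: "f * w = f * p"
    unfolding w_def using ff by (simp add: algebra_simps mult.assoc[symmetric])
  have wz: "w * z = z * w" if "p * z = z * p" for z
  proof -
    have "f * (1 - p) * z = z * (f * (1 - p))"
      using fz[OF that] that by (simp add: algebra_simps) (metis mult.assoc)
    then show ?thesis unfolding w_def by (simp add: left_diff_distrib right_diff_distrib)
  qed
  have sz: "s * z = z * s" if "p * z = z * p" for z
    using is_inverse_commutes[OF s] wz[OF that] unfolding w_def by blast
  have w1: "w = (1 - f) + f * p" by (simp add: w_def algebra_simps)
  have ffz: "f * (f * z) = f * z" for z using ff by (simp add: mult.assoc[symmetric])
  have pfz: "p * (f * z) = f * (p * z)" for z using fp by (metis mult.assoc)
  \<comment> \<open>The two parts of \<open>w\<close> are orthogonal, so its cube is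
    \<open>(1 - f) + f * p ^ 3\<close>; the rest is the factorization of
    \<open>1 - p ^ 3\<close>.\<close>
  have w3: "w * (w * w) = 1 - (1 - p) * f * (1 + p + p ^ 2)"
    unfolding w1 by (simp add: algebra_simps ffz pfz ff fp[symmetric] power2_eq_square)
  define u where "u = s * (s * s)"
  have sw': "s * (w * z) = z" "w * (s * z) = z" for z
    using ws by (simp_all add: mult.assoc[symmetric])
  have "is_inverse (w * (w * w)) u"
    unfolding is_inverse_def u_def by (simp add: mult.assoc sw' ws)
  moreover have "u \<in> comm2 p"
  proof (unfold comm2_def comm_def, clarify)
    fix z assume "p * z = z * p"
    from sz[OF this] show "u * z = z * u" unfolding u_def by (metis mult.assoc)
  qed
  moreover have "u * f * p ^ 3 = f"
  proof -
    have "f * p ^ 3 = f * p * p * p" by (simp add: power3_eq_cube mult.assoc)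
    also have "\<dots> = w * w * w * f" using fw fp wz by (metis mult.assoc)
    finally have "u * (f * p ^ 3) = f" unfolding u_def by (simp add: mult.assoc sw')
    then show ?thesis by (simp add: mult.assoc)
  qed
  ultimately show ?thesis unfolding w3 f_def by blast
qed

section \<open>Passing from \<open>1 - p\<close> to \<open>1 - q\<close>\<close>

lemma one_minus_power_square_eq:
  fixes p q :: "'a::{ring,monoid_mult}"
  assumes p2: "p * p = q * q" and p3: "p * p * p = q * q * q"
  shows "(1 - (1 - p) ^ n) * (1 - (1 - p) ^ n) = (1 - (1 - q) ^ n) * (1 - (1 - q) ^ n)"
proof -
  \<comment> \<open>\<open>g\<close> and \<open>h\<close> stand for the values at \<open>p\<close>
    and \<open>q\<close> of one polynomial, the quotient of \<open>1 - (1 - X) ^ n\<close> by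
    \<open>X\<close>.\<close>
  have "\<exists>g h. p * g = g * p \<and> q * h = h * q \<and> p * p * g = q * q * h \<and>
      1 - (1 - p) ^ n = p * g \<and> 1 - (1 - q) ^ n = q * h"
  proof (induction n)
    case 0
    show ?case by (rule exI[of _ 0], rule exI[of _ 0]) simp
  next
    case (Suc n)
    then obtain g h where *: "p * g = g * p" "q * h = h * q" "p * p * g = q * q * h"
      "1 - (1 - p) ^ n = p * g" "1 - (1 - q) ^ n = q * h" by blast
    have "p * p * p * g = q * q * q * h" using p2 p3 *(3) by (metis mult.assoc)
    \<comment> \<open>The next quotient comes from
      \<open>1 - (1 - p) * (1 - p * g) = p * (g + 1 - p * g)\<close>.\<close>
    then have "p * p * (g + 1 - p * g) = q * q * (h + 1 - q * h)"
      using p2 *(3) by (simp add: algebra_simps)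
    moreover have "p * (g + 1 - p * g) = (g + 1 - p * g) * p"
      using *(1) by (simp add: algebra_simps) (metis mult.assoc)
    moreover have "q * (h + 1 - q * h) = (h + 1 - q * h) * q"
      using *(2) by (simp add: algebra_simps) (metis mult.assoc)
    moreover have pow: "(1 - p) ^ n = 1 - p * g" "(1 - q) ^ n = 1 - q * h"
      using *(4,5) by (simp_all add: algebra_simps)
    have "1 - (1 - p) ^ Suc n = p * (g + 1 - p * g)" "1 - (1 - q) ^ Suc n = q * (h + 1 - q * h)"
      unfolding power_Suc pow by (simp_all add: algebra_simps)
    ultimately show ?case by blast
  qed
  then obtain g h where *: "p * g = g * p" "q * h = h * q" "p * p * g = q * q * h"
    "1 - (1 - p) ^ n = p * g" "1 - (1 - q) ^ n = q * h" by blast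
  \<comment> \<open>The factors are exchanged one at a time: \<open>p * p * g = q * q * h\<close>
    turns one \<open>g\<close> into \<open>h\<close>, and then \<open>q * q = p * p\<close> prepares
    the same replacement for the other.\<close>
  have "(p * g) * (p * g) = p * p * g * g" using *(1) by (metis mult.assoc)
  also have "\<dots> = h * (p * p * g)" using *(2,3) p2 by (metis mult.assoc)
  also have "\<dots> = (q * h) * (q * h)" using *(2,3) by (metis mult.assoc)
  finally show ?thesis using *(4,5) by simp
qed

text \<open>Elements with equal squares have equal even powers, so doubling the exponent
  suffices.\<close>

lemma sqrt_jacobson_radical_square_eq:
  fixes w w' :: "'a::{ring,monoid_mult}"
  assumes "w \<in> sqrt_jacobson_radical" "w * w = w' * w'"
  shows "w' \<in> sqrt_jacobson_radical"
proof -
  obtain k where k: "k \<ge> 1" "w ^ k \<in> jacobson_radical"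
    using assms(1) unfolding sqrt_jacobson_radical_def by blast
  have "w' ^ (2 * k) = (w * w) ^ k" using assms(2) by (simp add: power_mult power2_eq_square)
  also have "\<dots> = w ^ k * w ^ k" by (rule commuting_power_mult) simp
  finally have "w' ^ (2 * k) \<in> jacobson_radical" using jacobson_radical_mult_left[OF k(2)] by simp
  moreover have "2 * k \<ge> 1" using k(1) by simp
  ultimately show ?thesis unfolding sqrt_jacobson_radical_def by blast
qed

text \<open>The formula for \<open>y\<close> inverts \<open>1 - q\<close> on the corner of
  \<open>e\<close>: formally \<open>1 / (1 - X) = 1 + X + X ^ 2 / (1 - X)\<close>, the last term
  takes the same value at \<open>p\<close> and \<open>q\<close>, and \<open>x\<close> plays the role
  of \<open>1 / (1 - p)\<close>. The relations \<open>p2\<close> and \<open>p3\<close> are symmetric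
  in \<open>p\<close> and \<open>q\<close>, so the lemma serves both directions.\<close>

lemma pns_inverse_transfer:
  fixes p q x :: "'a::star_ring"
  assumes x: "is_pns_star_Drazin_inverse n (1 - p) x" and n: "n \<ge> 1"
    and p2: "p * p = q * q" and p3: "p * p * p = q * q * q"
  defines "e \<equiv> (1 - p) * x"
  defines "y \<equiv> e + e * q + x * p ^ 2"
  shows "is_pns_star_Drazin_inverse n (1 - q) y \<and> (1 - q) * y = e"
proof -
  define f where "f = 1 - e"
  obtain u where u: "u \<in> comm2 p" "u * f * p ^ 3 = f"
    using pns_inverse_unit[OF x n] unfolding f_def e_def by blast
  have xz: "x * z = z * x" if "p * z = z * p" for z
    using pns_inverse_commutes[OF x] that by (simp add: algebra_simps)
  have ez: "e * z = z * e" if "p * z = z * p" for z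
    using xz[OF that] that unfolding e_def by (simp add: algebra_simps) (metis mult.assoc)
  have fz: "f * z = z * f" if "p * z = z * p" for z
    using ez[OF that] unfolding f_def by (simp add: algebra_simps)
  have uz: "u * z = z * u" if "p * z = z * p" for z
    using u(1) that unfolding comm2_def comm_def by simp
  have ee: "e * e = e" using pns_inverse_idempotent[OF x] unfolding e_def .
  have ex: "e * x = x"
    using x xz[of p] unfolding e_def is_pns_star_Drazin_inverse_def
    by (simp add: algebra_simps)
  have p4: "p * (p * (p * p)) = q * (q * (q * q))" using p2 by (metis mult.assoc)
  have f1: "f = u * (f * (p * (p * p)))" using u(2) by (simp add: power3_eq_cube mult.assoc)
  have f2: "f = p * (p * p) * (u * f)"
  proof -
    have "p * (p * (p * p)) = (p * (p * p)) * p" by (simp add: mult.assoc)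
    from f1 uz[OF this] fz[OF this] show ?thesis by (metis mult.assoc)
  qed
  \<comment> \<open>By \<open>f1\<close> and \<open>f2\<close>, \<open>f\<close> has a factor
    \<open>p ^ 3\<close> on either side; next to it \<open>q\<close> can be replaced by
    \<open>p\<close>, since third and fourth powers of \<open>p\<close> and \<open>q\<close>
    agree.\<close>
  have fq: "f * q = f * p"
  proof -
    have "p * (p * p) * q = p * (p * p) * p" using p3 p4 by (metis mult.assoc)
    then show ?thesis using f1 by (metis mult.assoc)
  qed
  have qf: "q * f = p * f"
  proof -
    have "q * (p * (p * p)) = p * (p * (p * p))" using p3 p4 by (metis mult.assoc)
    then show ?thesis using f2 by (metis mult.assoc)
  qed
  have fp: "f * p = p * f" using fz[of p] by simp
  have eq: "e * q = q * e" using fq qf fp unfolding f_def by (simp add: algebra_simps)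
  \<comment> \<open>Such a \<open>z\<close> need not commute with \<open>p\<close>, but it commutes
    with \<open>t = p ^ 3 = q ^ 3\<close> and with \<open>t * p = q ^ 4\<close>. Hence
    \<open>t * z\<close> commutes with \<open>p\<close> and so with \<open>f\<close>. Writing
    \<open>f\<close> as a multiple of \<open>t\<close> then shows that \<open>f * z\<close> and
    \<open>z * f\<close> both equal \<open>f * z * f\<close>.\<close>
  have fzq: "f * z = z * f" if z: "q * z = z * q" for z
  proof -
    define t where "t = p * (p * p)"
    have tz: "t * z = z * t" unfolding t_def using p3 z by (simp add: mult.assoc) (metis mult.assoc)
    have tpz: "t * p * z = z * (t * p)"
      unfolding t_def using p4 z by (simp add: mult.assoc) (metis mult.assoc)
    have pt: "p * t = t * p" unfolding t_def by (simp add: mult.assoc)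
    have "p * (t * z) = t * z * p" using tz tpz pt by (metis mult.assoc)
    then have ftz: "f * (t * z) = t * z * f" by (rule fz)
    have ff: "f * f = f" using ee unfolding f_def by (simp add: algebra_simps)
    have fu: "f = u * (f * t)" "f = t * (u * f)" using f1 f2 t_def by simp_all
    have uf: "u * f = f * u" using fz uz by metis
    have "f * z = u * (t * z * f)" using fu(1) ftz by (metis mult.assoc)
    then have 1: "f * z * f = f * z" using ff by (metis mult.assoc)
    have "z * f = f * t * z * u" using fu(2) ftz tz uf by (metis mult.assoc)
    then have 2: "f * (z * f) = z * f" using ff by (metis mult.assoc)
    show ?thesis using 1 2 by (simp add: mult.assoc)
  qed
  have ezq: "e * z = z * e" if "q * z = z * q" for z
    using fzq[OF that] unfolding f_def by (simp add: algebra_simps)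
  have xp2: "x * p ^ 2 = p ^ 2 * x" by (rule xz) (simp add: power2_eq_square mult.assoc)
  have qp2: "q * p ^ 2 = p * p ^ 2" "p ^ 2 * q = p ^ 2 * p"
    unfolding power2_eq_square using p2 p3 by (metis mult.assoc)+
  have xp: "x * p = p * x" by (rule xz) simp
  have eqq: "e * q * q = q * (e * q)" using eq by (metis mult.assoc)
  have yq: "y * q = q * y"
  proof -
    have "x * p ^ 2 * q = q * (x * p ^ 2)" using xp2 qp2 xp by (metis mult.assoc power2_eq_square)
    then show ?thesis unfolding y_def using eq eqq by (simp add: distrib_left distrib_right)
  qed
  have qy: "(1 - q) * y = e"
  proof -
    have "q * x * p ^ 2 = p * x * p ^ 2" using xp2 qp2 xp by (metis mult.assoc)
    then have "(1 - q) * x * p ^ 2 = e * p ^ 2"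
      unfolding e_def by (simp add: algebra_simps)
    also have "\<dots> = e * q * q" using p2 by (simp add: power2_eq_square mult.assoc)
    finally have *: "(1 - q) * (x * p ^ 2) = e * q * q" by (simp add: mult.assoc)
    have "(1 - q) * y = (1 - q) * (e + e * q) + (1 - q) * (x * p ^ 2)"
      unfolding y_def by (simp add: distrib_left)
    \<comment> \<open>The sum telescopes: \<open>(1 - q) * (e + e * q)\<close> is
      \<open>e - e * q * q\<close>.\<close>
    also have "\<dots> = e" unfolding * eqq by (simp add: distrib_left left_diff_distrib eq)
    finally show ?thesis .
  qed
  have ey: "e * y = y" unfolding y_def using ee ex by (simp add: distrib_left mult.assoc[symmetric])
  have ye: "y * e = y" using ezq[OF yq[symmetric]] ey by simp
  have yqy: "y * (1 - q) = e" using yq qy by (simp add: algebra_simps)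
  have "y \<in> comm2 (1 - q)"
  proof (simp, unfold comm2_def comm_def, clarify)
    fix z assume z: "q * z = z * q"
    then have z': "z * (1 - q) = (1 - q) * z" by (simp add: algebra_simps)
    \<comment> \<open>\<open>y\<close> inverts \<open>1 - q\<close> on the corner of
      \<open>e\<close>, and both \<open>e\<close> and \<open>1 - q\<close> commute with
      \<open>z\<close>.\<close>
    have "y * z = y * (z * ((1 - q) * y))" using ye ezq[OF z] qy by (metis mult.assoc)
    also have "\<dots> = y * (1 - q) * z * y" using z' by (metis mult.assoc)
    also have "\<dots> = z * y" using yqy ezq[OF z] ey by (metis mult.assoc)
    finally show "y * z = z * y" .
  qed
  moreover have "y * (1 - q) * y = y" using yqy ey by simp
  moreover have "star ((1 - q) * y) = (1 - q) * y"
    using x qy unfolding e_def is_pns_star_Drazin_inverse_def by simp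
  moreover have "(1 - q) ^ n - (1 - q) * y \<in> sqrt_jacobson_radical"
  proof (rule sqrt_jacobson_radical_square_eq)
    show "(1 - p) ^ n - e \<in> sqrt_jacobson_radical"
      using x unfolding is_pns_star_Drazin_inverse_def e_def by blast
    \<comment> \<open>The elements to compare are \<open>f - A\<close> and \<open>f - B\<close>.
      Their squares agree because \<open>f\<close> does not distinguish \<open>A\<close> from
      \<open>B\<close> on either side and \<open>A * A = B * B\<close>.\<close>
    define A B where "A = 1 - (1 - p) ^ n" and "B = 1 - (1 - q) ^ n"
    have f\<alpha>: "f * (1 - p) = (1 - p) * f" and f\<beta>: "f * (1 - q) = (1 - q) * f"
      and f\<alpha>\<beta>: "f * (1 - p) = f * (1 - q)"
      using fq qf fp by (simp_all add: algebra_simps)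
    have pow: "f * (1 - p) ^ i = f * (1 - q) ^ i" for i
    proof (induction i)
      case (Suc i)
      have "f * (1 - p) ^ Suc i = (1 - p) * (f * (1 - p) ^ i)"
        using f\<alpha> by (simp add: mult.assoc[symmetric])
      also have "\<dots> = f * (1 - q) * (1 - q) ^ i"
        unfolding Suc using f\<alpha> f\<alpha>\<beta> by (simp add: mult.assoc[symmetric])
      finally show ?case by (simp add: mult.assoc)
    qed simp
    moreover have "f * (1 - p) ^ i = (1 - p) ^ i * f" "f * (1 - q) ^ i = (1 - q) ^ i * f" for i
      using power_commuting_commutes f\<alpha> f\<beta> by metis+
    ultimately have "(1 - p) ^ i * f = (1 - q) ^ i * f" for i by metis
    with pow have "f * A = f * B" "A * f = B * f"
      unfolding A_def B_def by (simp_all add: left_diff_distrib right_diff_distrib)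
    moreover have "A * A = B * B"
      unfolding A_def B_def by (rule one_minus_power_square_eq[OF p2 p3])
    moreover have "(1 - p) ^ n - e = f - A" "(1 - q) ^ n - (1 - q) * y = f - B"
      unfolding qy f_def A_def B_def by (simp_all add: algebra_simps)
    ultimately show "((1 - p) ^ n - e) * ((1 - p) ^ n - e) =
        ((1 - q) ^ n - (1 - q) * y) * ((1 - q) ^ n - (1 - q) * y)"
      by (simp add: left_diff_distrib right_diff_distrib)
  qed
  ultimately show ?thesis using qy unfolding is_pns_star_Drazin_inverse_def by blast
qed

section \<open>The equivalence and the two explicit formulas\<close>

theorem theorem3p11:
  fixes a b c \<alpha> \<beta> :: "'a::star_ring" and n :: nat
  assumes "n \<ge> 1"
    and "a * b * a = b * a ^ 2"
    and "b * a ^ 2 = a ^ 2 * c"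
    and "a ^ 2 * c = a * c * a"
    and "\<alpha> = 1 - b * a"
    and "\<beta> = 1 - a * c"
  shows "(pns_star_Drazin_invertible n \<alpha> \<longleftrightarrow> pns_star_Drazin_invertible n \<beta>) \<and>
    (pns_star_Drazin_invertible n \<alpha> \<longrightarrow>
      (\<exists>u v.
        is_inverse (1 - \<alpha> * spectral_idem n \<alpha> * (\<Sum>i = 0..2. (b * a) ^ i)) u \<and>
        is_inverse (1 - \<beta> * spectral_idem n \<beta> * (\<Sum>i = 0..2. (a * c) ^ i)) v \<and>
        pns_star_Drazin_inv n \<alpha> =
          1 - b * spectral_idem n \<beta> * v * (a * c) ^ 2 * a
            + b * \<beta> * pns_star_Drazin_inv n \<beta> * a
            + b * pns_star_Drazin_inv n \<beta> * a * b * a \<and>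
        pns_star_Drazin_inv n \<beta> =
          1 - a * spectral_idem n \<alpha> * u * (b * a) ^ 2 * c
            + a * \<alpha> * pns_star_Drazin_inv n \<alpha> * c
            + a * pns_star_Drazin_inv n \<alpha> * c * a * c))"
proof -
  define p q where "p = b * a" and "q = a * c"
  have \<alpha>: "\<alpha> = 1 - p" and \<beta>: "\<beta> = 1 - q" using assms(5,6) by (simp_all add: p_def q_def)
  have h: "a * b * a = b * a * a" "b * a * a = a * a * c" "a * a * c = a * c * a"
    using assms(2-4) by (simp_all add: power2_eq_square mult.assoc)
  have pa: "p * a = a * p" and qa: "q * a = a * q" and ap: "a * p = a * q"
    using h by (simp_all add: p_def q_def mult.assoc)
  have p2: "p * p = p * q" using ap by (simp add: p_def mult.assoc)
  have q2: "p * q = q * q" using h by (simp add: p_def q_def mult.assoc[symmetric])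
  have pq2: "p * p = q * q" using p2 q2 by simp
  have pq3: "p * p * p = q * q * q" using p2 q2 by (metis mult.assoc)
  have inv_iff: "pns_star_Drazin_invertible n \<alpha> \<longleftrightarrow> pns_star_Drazin_invertible n \<beta>"
    unfolding pns_star_Drazin_invertible_def \<alpha> \<beta>
    using pns_inverse_transfer[OF _ assms(1) pq2 pq3]
      pns_inverse_transfer[OF _ assms(1) pq2[symmetric] pq3[symmetric]] by blast
  have sum3: "(\<Sum>i = 0..2. z ^ i) = 1 + z + z ^ 2" for z :: 'a
    by (simp add: numeral_2_eq_2)
  show ?thesis
  proof (intro conjI impI inv_iff)
    assume "pns_star_Drazin_invertible n \<alpha>"
    then obtain x where x: "is_pns_star_Drazin_inverse n (1 - p) x"
      unfolding pns_star_Drazin_invertible_def \<alpha> by blast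
    define e f y where "e = (1 - p) * x" and "f = 1 - e" and "y = e + e * q + x * p ^ 2"
    have y: "is_pns_star_Drazin_inverse n (1 - q) y" and ye: "(1 - q) * y = e"
      using pns_inverse_transfer[OF x assms(1) pq2 pq3] unfolding e_def y_def by blast+
    \<comment> \<open>Transferring back from \<open>q\<close> to \<open>p\<close> yields an inverse
      of \<open>1 - p\<close> written in terms of \<open>y\<close>; by uniqueness it is
      \<open>x\<close>.\<close>
    have xy: "x = e + e * p + y * q ^ 2"
      using pns_inverse_transfer[OF y assms(1) pq2[symmetric] pq3[symmetric]] ye
        pns_inverse_unique[OF x _ assms(1)] by metis
    have inv_\<alpha>: "pns_star_Drazin_inv n \<alpha> = x" and inv_\<beta>: "pns_star_Drazin_inv n \<beta> = y"
      using pns_star_Drazin_inv_eqI x y assms(1) \<alpha> \<beta> by auto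
    have sp: "spectral_idem n \<alpha> = f" "spectral_idem n \<beta> = f"
      unfolding spectral_idem_def inv_\<alpha> inv_\<beta> f_def using \<alpha> \<beta> ye e_def by simp_all
    obtain u where u: "is_inverse (1 - (1 - p) * f * (1 + p + p ^ 2)) u" "u \<in> comm2 p"
      "u * f * p ^ 3 = f"
      using pns_inverse_unit[OF x assms(1)] unfolding f_def e_def by blast
    obtain v where v: "is_inverse (1 - (1 - q) * f * (1 + q + q ^ 2)) v" "v \<in> comm2 q"
      "v * f * q ^ 3 = f"
      using pns_inverse_unit[OF y assms(1)] unfolding f_def ye by blast
    have xz: "x * z = z * x" if "p * z = z * p" for z
      using pns_inverse_commutes[OF x] that by (simp add: algebra_simps)
    have yz: "y * z = z * y" if "q * z = z * q" for z
      using pns_inverse_commutes[OF y] that by (simp add: algebra_simps)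
    have ezp: "e * z = z * e" if "p * z = z * p" for z
      using xz[OF that] that unfolding e_def by (simp add: algebra_simps) (metis mult.assoc)
    have ezq: "e * z = z * e" if "q * z = z * q" for z
      using yz[OF that] that unfolding ye[symmetric] by (simp add: algebra_simps) (metis mult.assoc)
    have fzp: "f * z = z * f" if "p * z = z * p" for z
      using ezp[OF that] unfolding f_def by (simp add: algebra_simps)
    have fzq: "f * z = z * f" if "q * z = z * q" for z
      using ezq[OF that] unfolding f_def by (simp add: algebra_simps)
    have uz: "u * z = z * u" if "p * z = z * p" for z
      using u(2) that unfolding comm2_def comm_def by simp
    have vz: "v * z = z * v" if "q * z = z * q" for z
      using v(2) that unfolding comm2_def comm_def by simp
    have ea: "e * a = a * e" using ezp[OF pa] .
    have fa: "f * a = a * f" using fzp[OF pa] .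

    \<comment> \<open>This turns \<open>1\<close> minus the first correction term into
      \<open>e\<close>. Moving \<open>a\<close> next to \<open>b\<close> creates \<open>p\<close>,
      and \<open>p * q ^ 2 = q ^ 3\<close> supplies the cube that \<open>v\<close> cancels on
      \<open>f\<close>.\<close>
    have B1: "b * f * v * q ^ 2 * a = f"
    proof -
      have "q ^ 2 * a = a * q ^ 2" using qa unfolding power2_eq_square by (metis mult.assoc)
      then have "b * f * v * q ^ 2 * a = b * (f * (v * a)) * q ^ 2" by (simp add: mult.assoc)
      also have "\<dots> = p * (f * v * q ^ 2)" using vz[OF qa] fa unfolding p_def by (metis mult.assoc)
      also have "f * v * q ^ 2 = q ^ 2 * (v * f)"
        using vz[of "q ^ 2"] fzq[of "q ^ 2"] vz[of f] fzq[of q]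
        by (simp add: power2_eq_square mult.assoc) (metis mult.assoc)
      also have "p * \<dots> = q ^ 3 * (v * f)"
        using q2 by (simp add: power2_eq_square power3_eq_cube mult.assoc[symmetric])
      also have "\<dots> = v * f * q ^ 3"
        using vz[of "q ^ 3"] fzq[of "q ^ 3"]
        by (simp add: power3_eq_cube mult.assoc) (metis mult.assoc)
      finally show ?thesis using v(3) by simp
    qed
    have B2: "b * \<beta> * y * a = e * p"
      using ye ea ezp[of p] unfolding \<beta> p_def by (metis mult.assoc)
    \<comment> \<open>The trailing \<open>a * b * a\<close> is \<open>a * p = a * q\<close>; moving
      that \<open>a\<close> past \<open>y\<close> forms \<open>p\<close>, and
      \<open>p * q = q * q\<close>.\<close>
    have B3: "b * y * a * b * a = y * q ^ 2"
    proof -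
      have "b * y * a * b * a = b * (y * a) * q" using ap unfolding p_def by (metis mult.assoc)
      also have "\<dots> = p * (y * q)" using yz[OF qa] unfolding p_def by (simp add: mult.assoc)
      also have "\<dots> = q * q * y" using yz[of q] q2 by (metis mult.assoc)
      also have "\<dots> = y * q ^ 2" using yz[of q] unfolding power2_eq_square by (metis mult.assoc)
      finally show ?thesis .
    qed
    \<comment> \<open>Here \<open>a\<close> moves right to meet \<open>c\<close> and form
      \<open>q\<close>, and \<open>p ^ 2 * q = p ^ 3\<close> supplies the cube that \<open>u\<close>
      cancels.\<close>
    have A1: "a * f * u * p ^ 2 * c = f"
    proof -
      have "a * p ^ 2 = p ^ 2 * a" using pa unfolding power2_eq_square by (metis mult.assoc)
      moreover have "a * f * u = f * u * a" using fa uz[OF pa] by (metis mult.assoc)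
      ultimately have "a * f * u * p ^ 2 * c = f * u * p ^ 2 * q"
        unfolding q_def by (simp add: mult.assoc[symmetric]) (simp add: mult.assoc)
      also have "\<dots> = f * u * p ^ 3"
        using p2[symmetric] by (simp add: power2_eq_square power3_eq_cube mult.assoc)
      also have "\<dots> = u * f * p ^ 3" using uz[OF fzp[of p, symmetric]] by metis
      finally show ?thesis using u(3) by simp
    qed
    have A2: "a * \<alpha> * x * c = e * q"
      using ea unfolding \<alpha> e_def q_def by (metis mult.assoc)
    have A3: "a * x * c * a * c = x * p ^ 2"
      using xz[OF pa] pq2 unfolding q_def power2_eq_square by (metis mult.assoc)
    \<comment> \<open>After the three evaluations this is \<open>x = e + e * p + y * q ^ 2\<close>,
      the formula from the transfer back.\<close>
    have "x = 1 - b * f * v * q ^ 2 * a + b * \<beta> * y * a + b * y * a * b * a"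
      unfolding B1 B2 B3 using xy by (simp add: f_def)
    moreover have "y = 1 - a * f * u * p ^ 2 * c + a * \<alpha> * x * c + a * x * c * a * c"
      unfolding A1 A2 A3 by (simp add: f_def y_def)
    ultimately show "\<exists>u v.
        is_inverse (1 - \<alpha> * spectral_idem n \<alpha> * (\<Sum>i = 0..2. (b * a) ^ i)) u \<and>
        is_inverse (1 - \<beta> * spectral_idem n \<beta> * (\<Sum>i = 0..2. (a * c) ^ i)) v \<and>
        pns_star_Drazin_inv n \<alpha> =
          1 - b * spectral_idem n \<beta> * v * (a * c) ^ 2 * a
            + b * \<beta> * pns_star_Drazin_inv n \<beta> * a
            + b * pns_star_Drazin_inv n \<beta> * a * b * a \<and>
        pns_star_Drazin_inv n \<beta> =
          1 - a * spectral_idem n \<alpha> * u * (b * a) ^ 2 * c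
            + a * \<alpha> * pns_star_Drazin_inv n \<alpha> * c
            + a * pns_star_Drazin_inv n \<alpha> * c * a * c"
      using u(1)[folded \<alpha>] v(1)[folded \<beta>]
      unfolding sp inv_\<alpha> inv_\<beta> sum3 p_def[symmetric] q_def[symmetric] by blast
  qed
qed

end
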